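(* Let $q$ be a power of an odd prime with $q\equiv 1\pmod 3$, and let $\zeta\in\mathbb{F}_q^{\ast}$ be an element of order $3$. Let $m,d$ be positive integers with $q-1=md$ and $d\equiv 0\pmod 3$. Let $u,v,w\in\mathbb{F}_q^{\ast}$ have multiplicative orders $m_0,m_1,m_2$ respectively, each dividing $m$, and write $n_i=m/m_i$ for $i=0,1,2$. Put $a=(u+v\zeta+w\zeta^2)/3$, $b=(u+v\zeta^2+w\zeta)/3$, $c=(u+v+w)/3$ and $f(x)=ax^{(2q+1)/3}+bx^{(q+2)/3}+cx$. Then: (i) $f$ is a permutation polynomial of $\mathbb{F}_q$; (ii) the permutation induced by $f$ has cycle type $1+m_0^{dn_0/3}+m_1^{dn_1/3}+m_2^{dn_2/3}$; (iii) the inverse permutation is induced by the trinomial $a'x^{(2q+1)/3}+b'x^{(q+2)/3}+c'x$, where $a'=(u^{-1}+v^{-1}\zeta+w^{-1}\zeta^2)/3$, $b'=(u^{-1}+v^{-1}\zeta^2+w^{-1}\zeta)/3$ and $c'=(u^{-1}+v^{-1}+w^{-1})/3$.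
   Context: The order of a nonzero element means its order in $\mathbb{F}_q^{\ast}$. A cycle type $1+m_0^{k_0}+m_1^{k_1}+m_2^{k_2}$ means the permutation has exactly one fixed point and otherwise consists of $k_i$ disjoint cycles of length $m_i$ for $i=0,1,2$ (counts adding when some $m_i$ coincide). *)

theory Defs
  imports
    "HOL-Library.Cardinality"
    "HOL-Library.Multiset"
    "HOL-Combinatorics.Orbits"
    "HOL-Computational_Algebra.Polynomial"
begin

(* Only meaningful for elements of finite order, hence for every nonzero element of a
   finite field. *)
definition mult_order :: "'a::field \<Rightarrow> nat" where
  "mult_order x = (LEAST n. 0 < n \<and> x ^ n = 1)"

definition permutation_poly :: "'a::{field,finite} poly \<Rightarrow> bool" where
  "permutation_poly f \<longleftrightarrow> bij (poly f)"

(* The multiset of the lengths of the disjoint cycles of a permutation of a finite type.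
   The range is a set, so each cycle is counted once; fixed points contribute entries 1. *)
definition cycle_type :: "('a::finite \<Rightarrow> 'a) \<Rightarrow> nat multiset" where
  "cycle_type \<pi> = image_mset card (mset_set (range (orbit \<pi>)))"

(* The divisions by 3 in the exponents are exact when q is 1 modulo 3. *)
definition trinomial :: "nat \<Rightarrow> 'a::field \<Rightarrow> 'a \<Rightarrow> 'a \<Rightarrow> 'a poly" where
  "trinomial q a b c = monom a ((2 * q + 1) div 3) + monom b ((q + 2) div 3) + monom c 1"

end

theory Submission
  imports Defs
begin

text \<open>
  Put \<open>s = (q - 1) / 3\<close>. Then \<open>f(x) = x (a t\<^sup>2 + b t + c)\<close> with \<open>t = x\<^sup>s\<close>, and for \<open>x \<noteq> 0\<close> the
  value \<open>t\<close> is one of \<open>1, \<zeta>, \<zeta>\<^sup>2\<close>. The coefficients are the discrete Fourier transform of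
  \<open>(u, v, w)\<close>, so \<open>f\<close> multiplies by \<open>u\<close>, \<open>v\<close>, \<open>w\<close> on the three classes. Since the orders of
  \<open>u, v, w\<close> divide \<open>s\<close>, the classes are invariant; each has \<open>s\<close> elements, and on it all cycles
  have length the order of the multiplier.
\<close>

section \<open>Orders of nonzero elements of a finite field\<close>

text \<open>Multiplication by \<open>x\<close> permutes the nonzero elements, so scaling every
  factor leaves their product unchanged; that product is nonzero and cancels.\<close>

lemma finite_field_power_card_minus_one:
  fixes x :: "'a::{field,finite}"
  assumes "x \<noteq> 0"
  shows "x ^ (CARD('a) - 1) = 1"
proof -
  let ?P = "\<Prod>y\<in>UNIV - {0::'a}. y"
  have "bij_betw ((*) x) (UNIV - {0}) (UNIV - {0})"
    by (rule bij_betw_byWitness[where f' = "\<lambda>y. y / x"]) (use assms in auto)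
  then have "?P = (\<Prod>y\<in>UNIV - {0}. x * y)"
    by (rule prod.reindex_bij_betw[symmetric])
  also have "\<dots> = x ^ (CARD('a) - 1) * ?P"
    by (simp add: prod.distrib card_Diff_singleton)
  finally have "x ^ (CARD('a) - 1) * ?P = 1 * ?P"
    by simp
  moreover have "?P \<noteq> 0"
    by simp
  ultimately show ?thesis
    by (metis mult_right_cancel)
qed

lemma
  fixes x :: "'a::{field,finite}"
  assumes "x \<noteq> 0"
  shows mult_order_pos: "0 < mult_order x"
    and power_mult_order: "x ^ mult_order x = 1"
proof -
  \<comment> \<open>Since 0 and 1 differ, \<open>CARD('a) - 1\<close> is positive and serves as the
    witness that \<open>LEAST\<close> in \<open>mult_order\<close> needs.\<close>
  have "card {0, 1 :: 'a} \<le> CARD('a)"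
    by (intro card_mono) auto
  then have "0 < CARD('a) - 1"
    by simp
  with finite_field_power_card_minus_one[OF assms]
  have "0 < mult_order x \<and> x ^ mult_order x = 1"
    unfolding mult_order_def by (intro LeastI) blast
  then show "0 < mult_order x" "x ^ mult_order x = 1"
    by simp_all
qed

lemma mult_order_le: "0 < n \<Longrightarrow> x ^ n = 1 \<Longrightarrow> mult_order x \<le> n"
  unfolding mult_order_def by (rule Least_le) simp

lemma power_eq_1_if_mult_order_dvd:
  fixes x :: "'a::{field,finite}"
  assumes "x \<noteq> 0" "mult_order x dvd n"
  shows "x ^ n = 1"
  using assms by (auto simp: power_mult power_mult_order elim!: dvdE)

lemma inj_on_power_mult_order:
  fixes g :: "'a::{field,finite}"
  assumes "g \<noteq> 0"
  shows "inj_on (\<lambda>n. g ^ n) {..<mult_order g}"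
proof (rule linorder_inj_onI)
  fix i j assume ij: "i < j" "j \<in> {..<mult_order g}"
  show "g ^ i \<noteq> g ^ j"
  proof
    assume "g ^ i = g ^ j"
    also have "\<dots> = g ^ i * g ^ (j - i)"
      using ij by (simp flip: power_add)
    finally have "g ^ (j - i) = 1"
      using assms by simp
    then show False
      using mult_order_le[of "j - i" g] ij by simp
  qed
qed auto

section \<open>Cycle lengths on invariant sets\<close>

text \<open>Iterates of \<open>x\<close> are its multiples by powers of \<open>g\<close>. Invariance
  of \<open>A\<close> keeps them where the scaling law holds, and \<open>x\<close> being nonzero
  makes distinct powers give distinct points.\<close>

lemma card_orbit_scaling:
  fixes g :: "'a::{field,finite}"
  assumes "g \<noteq> 0" and "0 \<notin> A" and "x \<in> A"
    and inv: "\<And>y. y \<in> A \<Longrightarrow> \<pi> y \<in> A" and scale: "\<And>y. y \<in> A \<Longrightarrow> \<pi> y = g * y"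
  shows "card (orbit \<pi> x) = mult_order g"
proof -
  have "(\<pi> ^^ n) x = g ^ n * x \<and> (\<pi> ^^ n) x \<in> A" for n
    by (induction n) (use assms in \<open>auto simp: mult.assoc\<close>)
  then have pow: "(\<pi> ^^ n) x = g ^ n * x" for n
    by blast
  \<comment> \<open>An \<open>orbit\<close> starts at \<open>\<pi> x\<close>, so listing it from
    exponent 0 uses that \<open>\<pi>\<close> returns to \<open>x\<close> after
    \<open>mult_order g\<close> steps.\<close>
  have "orbit \<pi> x = {(\<pi> ^^ n) x |n. n < mult_order g}"
    using assms(1) by (intro orbit_altdef_bounded) (simp_all add: pow power_mult_order mult_order_pos)
  also have "\<dots> = (\<lambda>y. y * x) ` (\<lambda>n. g ^ n) ` {..<mult_order g}"
    by (auto simp: pow)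
  also have "card \<dots> = mult_order g"
  proof -
    have "x \<noteq> 0"
      using assms by auto
    then have "inj_on (\<lambda>y. y * x) B" for B
      by (auto intro: inj_onI)
    then show ?thesis
      using inj_on_power_mult_order[OF assms(1)] by (simp add: card_image)
  qed
  finally show ?thesis .
qed

lemma orbit_subset_invariant:
  assumes "x \<in> A" and "\<And>y. y \<in> A \<Longrightarrow> \<pi> y \<in> A"
  shows "orbit \<pi> x \<subseteq> A"
proof
  fix y assume "y \<in> orbit \<pi> x"
  then show "y \<in> A"
    by induction (use assms in auto)
qed

text \<open>The orbits partition \<open>A\<close> into blocks of size \<open>l\<close>, so their
  number is the quotient of the cardinalities.\<close>

lemma cycle_lengths_uniform:
  fixes \<pi> :: "'a::finite \<Rightarrow> 'a"
  assumes "permutation \<pi>" and inv: "\<And>y. y \<in> A \<Longrightarrow> \<pi> y \<in> A"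
    and len: "\<And>x. x \<in> A \<Longrightarrow> card (orbit \<pi> x) = l" and "0 < l"
  shows "image_mset card (mset_set (orbit \<pi> ` A)) = replicate_mset (card A div l) l"
proof -
  have self: "x \<in> orbit \<pi> x" for x
    using assms(1) by (rule permutation_self_in_orbit)
  have "\<Union> (orbit \<pi> ` A) = A"
    using orbit_subset_invariant[of _ A \<pi>, OF _ inv] self by blast
  moreover have "c1 \<inter> c2 = {}"
    if "c1 \<in> orbit \<pi> ` A" "c2 \<in> orbit \<pi> ` A" "c1 \<noteq> c2" for c1 c2
    using that orbit_cyclic_eq3[OF cyclic_on_orbit'[OF assms(1)]] by blast
  ultimately have "l * card (orbit \<pi> ` A) = card A"
    using card_partition[of "orbit \<pi> ` A" l] len by fastforce
  then have "card A div l = card (orbit \<pi> ` A)"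
    using \<open>0 < l\<close> by (metis less_numeral_extra(3) nonzero_mult_div_cancel_left)
  moreover have "image_mset card (mset_set (orbit \<pi> ` A)) =
      image_mset (\<lambda>_. l) (mset_set (orbit \<pi> ` A))"
    by (rule image_mset_cong) (use len in auto)
  ultimately show ?thesis
    by (simp add: image_mset_const_eq)
qed

text \<open>A common orbit would be counted only once on the left. It would have to lie in both
  invariant sets, but these are disjoint and orbits are nonempty.\<close>

lemma mset_set_orbit_Un:
  fixes \<pi> :: "'a::finite \<Rightarrow> 'a"
  assumes "A \<inter> B = {}"
    and "\<And>y. y \<in> A \<Longrightarrow> \<pi> y \<in> A" and "\<And>y. y \<in> B \<Longrightarrow> \<pi> y \<in> B"
  shows "mset_set (orbit \<pi> ` (A \<union> B)) = mset_set (orbit \<pi> ` A) + mset_set (orbit \<pi> ` B)"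
proof -
  have "orbit \<pi> ` A \<inter> orbit \<pi> ` B = {}"
  proof (rule ccontr)
    assume "orbit \<pi> ` A \<inter> orbit \<pi> ` B \<noteq> {}"
    then obtain x y where xy: "x \<in> A" "y \<in> B" "orbit \<pi> x = orbit \<pi> y"
      by auto
    then have "orbit \<pi> x \<subseteq> A \<inter> B"
      using orbit_subset_invariant[of x A \<pi>] orbit_subset_invariant[of y B \<pi>] assms by auto
    then show False
      using assms(1) orbit_nonempty[of \<pi> x] by auto
  qed
  then show ?thesis
    by (simp add: image_Un mset_set_Union)
qed

section \<open>Root counting and evaluation of the trinomial\<close>

lemma card_power_eq_le:
  fixes t :: "'a::{field,finite}"
  assumes "0 < s"
  shows "card {x. x ^ s = t} \<le> s"
proof -
  let ?p = "monom 1 s - [:t:]"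
  \<comment> \<open>As \<open>s\<close> is positive, the constant \<open>t\<close> does not touch
    this coefficient, so \<open>?p\<close> is nonzero and has at most \<open>s\<close>
    roots.\<close>
  have coeff: "coeff ?p s = 1"
    using assms by (simp add: coeff_pCons split: nat.split)
  have "degree ?p \<le> s"
    by (intro degree_diff_le) (simp_all add: degree_monom_le)
  moreover have "?p \<noteq> 0"
    using coeff by (metis coeff_0 zero_neq_one)
  moreover have "{x. x ^ s = t} = {x. poly ?p x = 0}"
    by (simp add: poly_monom)
  ultimately show ?thesis
    using card_poly_roots_bound[of ?p] by simp
qed

text \<open>For q = 3s + 1 the exponents are 2s + 1, s + 1 and 1. The factor multiplying
  \<open>x\<close> therefore depends on \<open>x ^ s\<close> alone.\<close>

lemma poly_trinomial:
  "poly (trinomial (3 * s + 1) a b c) x = (a * (x ^ s)\<^sup>2 + b * x ^ s + c) * x"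
proof -
  have "(2 * (3 * s + 1) + 1) div 3 = s * 2 + 1" "(3 * s + 1 + 2) div 3 = s + 1"
    by simp_all
  then show ?thesis
    unfolding trinomial_def by (simp add: poly_monom algebra_simps power_mult)
qed

section \<open>Cube roots of unity and Fourier inversion on three points\<close>

context
  fixes \<zeta> :: "'a::{field,finite}"
  assumes zeta_order: "mult_order \<zeta> = 3" and zeta_nz: "\<zeta> \<noteq> 0"
begin

lemma zeta_cube: "\<zeta> ^ 3 = 1"
  using power_mult_order[OF zeta_nz] by (simp add: zeta_order)

lemma zeta_neq_1: "\<zeta> \<noteq> 1"
  using mult_order_le[of 1 \<zeta>] zeta_order by auto

lemma zeta_square_neq_1: "\<zeta>\<^sup>2 \<noteq> 1"
  using mult_order_le[of 2 \<zeta>] by (auto simp: zeta_order)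

lemma zeta_sum: "1 + \<zeta> + \<zeta>\<^sup>2 = 0"
proof -
  have "(\<zeta> - 1) * (1 + \<zeta> + \<zeta>\<^sup>2) = \<zeta> ^ 3 - 1"
    by (simp add: algebra_simps power2_eq_square power3_eq_cube)
  then show ?thesis
    using zeta_neq_1 by (simp add: zeta_cube)
qed

text \<open>In characteristic 3 cubing is additive, so \<open>\<zeta> ^ 3 = 1\<close> would force
  \<open>\<zeta> = 1\<close>.\<close>

lemma three_neq_0: "(3::'a) \<noteq> 0"
proof
  assume "(3::'a) = 0"
  moreover have "(\<zeta> - 1) ^ 3 = \<zeta> ^ 3 - 1 - 3 * (\<zeta>\<^sup>2 - \<zeta>)"
    by (simp add: algebra_simps power2_eq_square power3_eq_cube)
  ultimately show False
    using zeta_neq_1 by (simp add: zeta_cube)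
qed

text \<open>The polynomial t^3 - 1 splits as the product of t - 1, t - \<open>\<zeta>\<close> and t
  - \<open>\<zeta>\<^sup>2\<close>.\<close>

lemma cube_eq_1_cases:
  assumes "t ^ 3 = (1::'a)"
  obtains "t = 1" | "t = \<zeta>" | "t = \<zeta>\<^sup>2"
proof -
  have "\<zeta>\<^sup>2 = - 1 - \<zeta>"
    using zeta_sum by algebra
  then have "(t - 1) * (t - \<zeta>) * (t - \<zeta>\<^sup>2) = t ^ 3 - 1"
    using zeta_cube by algebra
  then show ?thesis
    using assms that by auto
qed

lemma fourier_interpolation:
  fixes u v w :: 'a
  defines "a \<equiv> (u + v * \<zeta> + w * \<zeta>\<^sup>2) / 3"
    and "b \<equiv> (u + v * \<zeta>\<^sup>2 + w * \<zeta>) / 3"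
    and "c \<equiv> (u + v + w) / 3"
  shows "a + b + c = u" "a * \<zeta>\<^sup>2 + b * \<zeta> + c = v" "a * (\<zeta>\<^sup>2)\<^sup>2 + b * \<zeta>\<^sup>2 + c = w"
proof -
  have abc: "3 * a = u + v * \<zeta> + w * \<zeta>\<^sup>2" "3 * b = u + v * \<zeta>\<^sup>2 + w * \<zeta>" "3 * c = u + v + w"
    using three_neq_0 by (simp_all add: a_def b_def c_def)
  \<comment> \<open>Each combination below equals 3u, 3v or 3w plus an explicit multiple of
    \<open>?z\<close>, already as a polynomial identity in \<open>\<zeta>\<close>; for instance 2
    \<open>\<zeta> ^ 3\<close> + 1 = 3 + 2 (\<open>\<zeta> - 1\<close>) \<open>?z\<close>. Then
    \<open>?z = 0\<close> removes the multiple.\<close>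
  let ?z = "1 + \<zeta> + \<zeta>\<^sup>2"
  have "3 * (a + b + c) = 3 * a + 3 * b + 3 * c"
    by (simp add: algebra_simps)
  also have "\<dots> = 3 * u + (v + w) * ?z"
    unfolding abc by (simp add: algebra_simps)
  finally have u: "3 * (a + b + c) = 3 * u"
    by (simp add: zeta_sum)
  have "3 * (a * \<zeta>\<^sup>2 + b * \<zeta> + c) = 3 * a * \<zeta>\<^sup>2 + 3 * b * \<zeta> + 3 * c"
    by (simp add: algebra_simps)
  also have "\<dots> = 3 * v + (u + 2 * v * (\<zeta> - 1) + w * (1 - \<zeta> + \<zeta>\<^sup>2)) * ?z"
    unfolding abc by (simp add: algebra_simps power2_eq_square)
  finally have v: "3 * (a * \<zeta>\<^sup>2 + b * \<zeta> + c) = 3 * v"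
    by (simp add: zeta_sum)
  have "3 * (a * (\<zeta>\<^sup>2)\<^sup>2 + b * \<zeta>\<^sup>2 + c) = 3 * a * (\<zeta>\<^sup>2)\<^sup>2 + 3 * b * \<zeta>\<^sup>2 + 3 * c"
    by (simp add: algebra_simps)
  also have "\<dots> = 3 * w + (u * (1 - \<zeta> + \<zeta>\<^sup>2) + v * (\<zeta> ^ 3 - \<zeta> + 1)
      + w * (\<zeta> - 1) * (\<zeta> ^ 3 + 2)) * ?z"
    unfolding abc by (simp add: algebra_simps power2_eq_square power3_eq_cube)
  finally have w: "3 * (a * (\<zeta>\<^sup>2)\<^sup>2 + b * \<zeta>\<^sup>2 + c) = 3 * w"
    by (simp add: zeta_sum)
  from u v w show "a + b + c = u" "a * \<zeta>\<^sup>2 + b * \<zeta> + c = v" "a * (\<zeta>\<^sup>2)\<^sup>2 + b * \<zeta>\<^sup>2 + c = w"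
    using three_neq_0 by (metis mult_left_cancel)+
qed

section \<open>The three classes of nonzero elements, by the value of x^s\<close>

context
  fixes s :: nat
  assumes card_eq: "CARD('a) = 3 * s + 1"
begin

lemma s_pos: "0 < s"
proof -
  have "card {0, 1 :: 'a} \<le> CARD('a)"
    by (intro card_mono) auto
  then show ?thesis
    using card_eq by simp
qed

text \<open>The cube of \<open>x ^ s\<close> is \<open>x ^ (CARD('a) - 1)\<close>, which is
  1.\<close>

lemma power_class_cases:
  assumes "(x::'a) \<noteq> 0"
  obtains "x ^ s = 1" | "x ^ s = \<zeta>" | "x ^ s = \<zeta>\<^sup>2"
proof -
  have "(x ^ s) ^ 3 = 1"
    using finite_field_power_card_minus_one[OF assms] card_eq
    by (simp add: power_mult[symmetric] mult.commute)
  then show ?thesis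
    using that by (elim cube_eq_1_cases)
qed

lemma UNIV_eq_power_classes:
  "(UNIV :: 'a set) = {0} \<union> ({x. x ^ s = 1} \<union> ({x. x ^ s = \<zeta>} \<union> {x. x ^ s = \<zeta>\<^sup>2}))"
  using power_class_cases by blast

lemma zeta_neq_square: "\<zeta> \<noteq> \<zeta>\<^sup>2"
  using zeta_neq_1 zeta_nz by (simp add: power2_eq_square)

text \<open>Each of the three classes has at most \<open>s\<close> elements, and together they have \<open>3 s\<close>.\<close>

lemma card_power_class:
  assumes "t \<in> {1, \<zeta>, \<zeta>\<^sup>2}"
  shows "card {x::'a. x ^ s = t} = s"
proof -
  have "3 * s + 1 \<le> 1 + (card {x::'a. x ^ s = 1} + (card {x. x ^ s = \<zeta>} + card {x. x ^ s = \<zeta>\<^sup>2}))"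
  proof -
    have "3 * s + 1 = card ({0} \<union> ({x::'a. x ^ s = 1} \<union> ({x. x ^ s = \<zeta>} \<union> {x. x ^ s = \<zeta>\<^sup>2})))"
      using card_eq UNIV_eq_power_classes by simp
    also have "\<dots> \<le> card {0::'a} + (card {x::'a. x ^ s = 1} + (card {x. x ^ s = \<zeta>} + card {x. x ^ s = \<zeta>\<^sup>2}))"
      by (intro order_trans[OF card_Un_le] add_left_mono order_refl)
    finally show ?thesis by simp
  qed
  with card_power_eq_le[OF s_pos, of "1::'a"] card_power_eq_le[OF s_pos, of \<zeta>]
    card_power_eq_le[OF s_pos, of "\<zeta>\<^sup>2"] assms
  show ?thesis by auto
qed

section \<open>Maps that scale each class by a constant\<close>

context
  fixes \<pi> :: "'a \<Rightarrow> 'a" and u v w :: 'a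
  assumes zero: "\<pi> 0 = 0"
    and scale: "\<And>x. x ^ s = 1 \<Longrightarrow> \<pi> x = u * x" "\<And>x. x ^ s = \<zeta> \<Longrightarrow> \<pi> x = v * x"
      "\<And>x. x ^ s = \<zeta>\<^sup>2 \<Longrightarrow> \<pi> x = w * x"
    and nz: "u \<noteq> 0" "v \<noteq> 0" "w \<noteq> 0"
    and pow: "u ^ s = 1" "v ^ s = 1" "w ^ s = 1"
begin

text \<open>Each multiplier has s-th power 1, so \<open>\<pi> x\<close> stays in the class of
  \<open>x\<close>, and there \<open>\<rho>\<close> undoes the same multiplier.\<close>

lemma piecewise_scaling_inverse:
  assumes "\<rho> 0 = 0"
    and "\<And>x. x ^ s = 1 \<Longrightarrow> \<rho> x = inverse u * x" "\<And>x. x ^ s = \<zeta> \<Longrightarrow> \<rho> x = inverse v * x"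
      "\<And>x. x ^ s = \<zeta>\<^sup>2 \<Longrightarrow> \<rho> x = inverse w * x"
  shows "\<rho> (\<pi> x) = x"
proof (cases "x = 0")
  case True
  then show ?thesis by (simp add: zero assms)
next
  case False
  then show ?thesis
    by (rule power_class_cases) (simp_all add: scale assms nz pow power_mult_distrib)
qed

lemma piecewise_scaling_cycle_type:
  assumes "bij \<pi>"
  shows "cycle_type \<pi> = {#1#} + replicate_mset (s div mult_order u) (mult_order u)
    + replicate_mset (s div mult_order v) (mult_order v)
    + replicate_mset (s div mult_order w) (mult_order w)"
proof -
  define C where "C t = {x::'a. x ^ s = t}" for t
  have perm: "permutation \<pi>"
    using assms by (simp add: permutation)
  have inv: "\<pi> x \<in> C 1" if "x \<in> C 1" for x
    using that by (simp add: C_def scale pow power_mult_distrib)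
  have inv': "\<pi> x \<in> C \<zeta>" if "x \<in> C \<zeta>" for x
    using that by (simp add: C_def scale pow power_mult_distrib)
  have inv'': "\<pi> x \<in> C (\<zeta>\<^sup>2)" if "x \<in> C (\<zeta>\<^sup>2)" for x
    using that by (simp add: C_def scale pow power_mult_distrib)
  have uniform: "image_mset card (mset_set (orbit \<pi> ` C t)) =
      replicate_mset (s div mult_order g) (mult_order g)"
    if "t \<in> {1, \<zeta>, \<zeta>\<^sup>2}" "g \<noteq> 0" "\<And>x. x \<in> C t \<Longrightarrow> \<pi> x \<in> C t" "\<And>x. x \<in> C t \<Longrightarrow> \<pi> x = g * x"
    for t g
  proof -
    \<comment> \<open>For positive \<open>s\<close> the power \<open>0 ^ s\<close> is 0, whereas
      \<open>t\<close> is nonzero.\<close>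
    have "0 \<notin> C t"
      using that(1) s_pos zeta_nz by (auto simp: C_def power_0_left)
    then have "card (orbit \<pi> x) = mult_order g" if "x \<in> C t" for x
      using card_orbit_scaling[OF \<open>g \<noteq> 0\<close> _ \<open>x \<in> C t\<close>] \<open>\<And>x. x \<in> C t \<Longrightarrow> \<pi> x \<in> C t\<close>
        \<open>\<And>x. x \<in> C t \<Longrightarrow> \<pi> x = g * x\<close> by blast
    from cycle_lengths_uniform[OF perm that(3) this mult_order_pos[OF that(2)]]
    show ?thesis
      using card_power_class[OF that(1)] by (simp add: C_def)
  qed
  have disj: "{0} \<inter> (C 1 \<union> (C \<zeta> \<union> C (\<zeta>\<^sup>2))) = {}" "C 1 \<inter> (C \<zeta> \<union> C (\<zeta>\<^sup>2)) = {}"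
    "C \<zeta> \<inter> C (\<zeta>\<^sup>2) = {}"
    using s_pos zeta_nz zeta_neq_1 zeta_square_neq_1 zeta_neq_square by (auto simp: C_def power_0_left)
  have "range (orbit \<pi>) = orbit \<pi> ` ({0} \<union> (C 1 \<union> (C \<zeta> \<union> C (\<zeta>\<^sup>2))))"
    using UNIV_eq_power_classes by (simp add: C_def)
  also have "mset_set \<dots> = mset_set (orbit \<pi> ` {0}) + (mset_set (orbit \<pi> ` C 1)
      + (mset_set (orbit \<pi> ` C \<zeta>) + mset_set (orbit \<pi> ` C (\<zeta>\<^sup>2))))"
    \<comment> \<open>The right-nested union is peeled from the left: first \<open>{0}\<close>, then
      \<open>C 1\<close>, then \<open>C \<zeta>\<close>, each disjoint from the invariant
      rest.\<close>
    using inv inv' inv'' zero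
    by (subst mset_set_orbit_Un[OF disj(1)] mset_set_orbit_Un[OF disj(2)]
      mset_set_orbit_Un[OF disj(3)]; blast?)+
  also have "image_mset card \<dots> = {#1#} + (replicate_mset (s div mult_order u) (mult_order u)
    + (replicate_mset (s div mult_order v) (mult_order v)
    + replicate_mset (s div mult_order w) (mult_order w)))"
  proof -
    have "orbit \<pi> 0 = {0}"
      by (simp add: orbit_eq_singleton_iff zero)
    moreover note uniform[of 1 u, OF _ nz(1) inv] uniform[of \<zeta> v, OF _ nz(2) inv']
      uniform[of "\<zeta>\<^sup>2" w, OF _ nz(3) inv'']
    ultimately show ?thesis
      by (simp add: C_def scale)
  qed
  finally show ?thesis
    unfolding cycle_type_def by (simp add: add.assoc)
qed

end

end

end

section \<open>Permutation property, cycle type and inverse of the trinomial\<close>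

theorem mainTheorem4:
  fixes p k q m d m0 m1 m2 n0 n1 n2 :: nat
    and \<zeta> u v w a b c a' b' c' :: "'a::{field,finite}"
    and f :: "'a poly"
  assumes "prime p" and "odd p" and "0 < k" and "q = p ^ k"
    and "CARD('a) = q"
    and "q mod 3 = 1"
    and "\<zeta> \<noteq> 0" and "mult_order \<zeta> = 3"
    and "0 < m" and "0 < d" and "q - 1 = m * d" and "d mod 3 = 0"
    and "u \<noteq> 0" and "v \<noteq> 0" and "w \<noteq> 0"
    and "mult_order u = m0" and "mult_order v = m1" and "mult_order w = m2"
    and "m0 dvd m" and "m1 dvd m" and "m2 dvd m"
    and "n0 = m div m0" and "n1 = m div m1" and "n2 = m div m2"
    and "a = (u + v * \<zeta> + w * \<zeta>\<^sup>2) / 3"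
    and "b = (u + v * \<zeta>\<^sup>2 + w * \<zeta>) / 3"
    and "c = (u + v + w) / 3"
    and "f = trinomial q a b c"
    and "a' = (inverse u + inverse v * \<zeta> + inverse w * \<zeta>\<^sup>2) / 3"
    and "b' = (inverse u + inverse v * \<zeta>\<^sup>2 + inverse w * \<zeta>) / 3"
    and "c' = (inverse u + inverse v + inverse w) / 3"
  shows "permutation_poly f
    \<and> cycle_type (poly f) =
        {#1#} + replicate_mset (d * n0 div 3) m0
              + replicate_mset (d * n1 div 3) m1
              + replicate_mset (d * n2 div 3) m2
    \<and> inv (poly f) = poly (trinomial q a' b' c')"
proof -
  \<comment> \<open>This is (q - 1) / 3, written so that \<open>m\<close> visibly divides it; hence
    the orders of \<open>u\<close>, \<open>v\<close>, \<open>w\<close> divide it too.\<close>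
  define s where "s = m * (d div 3)"
  have d: "d = 3 * (d div 3)"
    using \<open>d mod 3 = 0\<close> by presburger
  have md: "m * d = 3 * s"
    unfolding s_def by (subst d) simp
  have q: "q = 3 * s + 1"
  proof -
    have "0 < q"
      using \<open>q mod 3 = 1\<close> by (intro gr0I) simp
    then show ?thesis
      using \<open>q - 1 = m * d\<close> md by linarith
  qed
  with \<open>CARD('a) = q\<close> have card: "CARD('a) = 3 * s + 1"
    by simp
  note zeta = \<open>mult_order \<zeta> = 3\<close> \<open>\<zeta> \<noteq> 0\<close>
  note nz = \<open>u \<noteq> 0\<close> \<open>v \<noteq> 0\<close> \<open>w \<noteq> 0\<close>
  have pow: "g ^ s = 1" if "g \<noteq> 0" "mult_order g dvd m" for g :: 'a
    using power_eq_1_if_mult_order_dvd[OF that] by (simp add: s_def power_mult)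
  have pows: "u ^ s = 1" "v ^ s = 1" "w ^ s = 1"
    using assms by (auto intro!: pow)
  have f: "poly f x = (a * (x ^ s)\<^sup>2 + b * x ^ s + c) * x" for x
    using \<open>f = trinomial q a b c\<close> by (simp only: q poly_trinomial)
  let ?g = "poly (trinomial q a' b' c')"
  have g: "?g x = (a' * (x ^ s)\<^sup>2 + b' * x ^ s + c') * x" for x
    by (simp only: q poly_trinomial)
  note interp = fourier_interpolation[OF zeta, of u v w, folded assms(25-27)]
  \<comment> \<open>The same inversion for the inverse multipliers shows that the second trinomial
    scales each class by the reciprocal factor.\<close>
  note interp' = fourier_interpolation[OF zeta, of "inverse u" "inverse v" "inverse w",
      folded assms(29-31)]
  have f_scale: "poly f 0 = 0" "\<And>x. x ^ s = 1 \<Longrightarrow> poly f x = u * x"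
    "\<And>x. x ^ s = \<zeta> \<Longrightarrow> poly f x = v * x" "\<And>x. x ^ s = \<zeta>\<^sup>2 \<Longrightarrow> poly f x = w * x"
    by (simp_all only: f interp power_one mult_1_right mult_zero_right)
  have g_scale: "?g 0 = 0" "\<And>x. x ^ s = 1 \<Longrightarrow> ?g x = inverse u * x"
    "\<And>x. x ^ s = \<zeta> \<Longrightarrow> ?g x = inverse v * x" "\<And>x. x ^ s = \<zeta>\<^sup>2 \<Longrightarrow> ?g x = inverse w * x"
    by (simp_all only: g interp' power_one mult_1_right mult_zero_right)
  have gf: "?g (poly f x) = x" for x
    by (rule piecewise_scaling_inverse[OF zeta card f_scale nz pows g_scale])
  \<comment> \<open>A left inverse gives injectivity, which on a finite field gives bijectivity; the
    left inverse is then the inverse.\<close>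
  have "inj (poly f)"
    by (metis gf injI)
  then have bij: "bij (poly f)"
    by (simp add: bij_def finite_UNIV_inj_surj)
  have "inv (poly f) = ?g"
    using bij gf by (metis bij_inv_eq_iff ext)
  moreover have count: "s div mult_order g = d * (m div mult_order g) div 3"
    if "mult_order g dvd m" for g :: 'a
  proof -
    \<comment> \<open>Both divisions are exact: 3 divides \<open>d\<close>, and the order divides
      \<open>m\<close>.\<close>
    have "d * (m div mult_order g) div 3 = (d div 3) * (m div mult_order g)"
      by (subst d) (simp add: mult.assoc)
    also have "\<dots> = s div mult_order g"
      unfolding s_def using that by (metis div_mult_swap mult.commute)
    finally show ?thesis ..
  qed
  then have "s div mult_order u = d * n0 div 3" "s div mult_order v = d * n1 div 3"
    "s div mult_order w = d * n2 div 3"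
    using assms by auto
  moreover note piecewise_scaling_cycle_type[OF zeta card f_scale nz pows bij]
  ultimately show ?thesis
    using bij by (simp add: permutation_poly_def assms(16-18))
qed

end
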